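(* Let $K_1,\ldots,K_n$ ($n\ge1$) be non-empty closed convex subsets of $d$-dimensional Euclidean space $(\mathbb{E}^d,\|\cdot\|)$, let $\bar{x}\in\mathbb{E}^d$, and let $f:\mathbb{E}^d\to\mathbb{R}$, $f(x)=\sum_{i=1}^n\mathrm{dist}(x,K_i)$. (a) (Floating case) If $\bar{x}\notin\bigcup_{i=1}^nK_i$, then $\bar{x}$ is a minimizer of $f$ if and only if $$\sum_{i=1}^n\frac{\mathrm{proj}(\bar{x},K_i)-\bar{x}}{\|\mathrm{proj}(\bar{x},K_i)-\bar{x}\|}=0.$$ (b) (Point absorbed case) If $\bar{x}\notin\bigcup_{i=1}^{n-1}K_i$ and $K_n=\{\bar{x}\}$, then $\bar{x}$ is a minimizer of $f$ if and only if $$\left\|\sum_{i=1}^{n-1}\frac{\mathrm{proj}(\bar{x},K_i)-\bar{x}}{\|\mathrm{proj}(\bar{x},K_i)-\bar{x}\|}\right\|\le 1.$$ (c) (Flat absorbed case) If $\bar{x}\notin\bigcup_{i=1}^{n-1}K_i$ and $\bar{x}\in K_n$, where $K_n$ is an affine flat, then $\bar{x}$ is a minimizer of $f$ if and only if $$\sum_{i=1}^{n-1}\frac{\mathrm{proj}(\bar{x},K_i)-\bar{x}}{\|\mathrm{proj}(\bar{x},K_i)-\bar{x}\|}\ \text{ is orthogonal to } K_n\qquad\text{and}\qquad\left\|\sum_{i=1}^{n-1}\frac{\mathrm{proj}(\bar{x},K_i)-\bar{x}}{\|\mathrm{proj}(\bar{x},K_i)-\bar{x}\|}\right\|\le 1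.$$
   Context: $\mathrm{dist}(x,K)=\inf\{\|y-x\|:y\in K\}$ is the Euclidean distance, and $\mathrm{proj}(x,K)$ is the unique point of the non-empty closed convex set $K$ nearest to $x$. An affine flat is an affine subspace. A vector is orthogonal to an affine flat $K$ containing $\bar{x}$ if it is orthogonal to the linear subspace $K-\bar{x}$. *)

theory Defs
  imports "HOL-Analysis.Analysis"
begin

definition sum_dist :: "(nat \<Rightarrow> 'a::euclidean_space set) \<Rightarrow> nat \<Rightarrow> 'a \<Rightarrow> real" where
  "sum_dist K n x = (\<Sum>i=1..n. infdist x (K i))"

definition unit_toward :: "'a::euclidean_space \<Rightarrow> 'a set \<Rightarrow> 'a" where
  "unit_toward x S = (closest_point S x - x) /\<^sub>R norm (closest_point S x - x)"

(* Intended for affine S with x in S, where the translate of S by -x is the linear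
   subspace of directions of S. *)
definition orthogonal_to_flat :: "'a::euclidean_space \<Rightarrow> 'a \<Rightarrow> 'a set \<Rightarrow> bool" where
  "orthogonal_to_flat v x S \<longleftrightarrow> (\<forall>u \<in> (\<lambda>y. y - x) ` S. orthogonal v u)"

end

theory Submission
  imports Defs
begin

text \<open>
  All three cases are one statement. The floating case is the flat case for the whole space, which
  may be added to the family because its distance function is zero and because only the zero vector
  is orthogonal to it; the absorbed point is the flat of dimension zero. So let \<open>F\<close> be the sum of
  the distances to the sets that avoid \<open>x\<close>, let \<open>U\<close> be the sum of the unit vectors from \<open>x\<close> towards
  them, and let \<open>S\<close> be the flat through \<open>x\<close>.

  Convexity of \<open>F\<close> and its gradient \<open>- U\<close> at \<open>x\<close> enter as a lower and an upper bound that both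
  touch \<open>F\<close> at \<open>x\<close>. From below, the half-space bounded by the supporting hyperplane at the
  projection gives \<open>F y \<ge> F x - U \<bullet> (y - x)\<close> (\<open>infdist_ge_linearization\<close>). From above, \<open>F y\<close>
  is at most the sum of the distances from \<open>y\<close> to the fixed projections of \<open>x\<close>, with equality at
  \<open>x\<close>, and this sum is differentiable at \<open>x\<close> with gradient \<open>- U\<close> (\<open>DERIV_norm_diff_line\<close>).
  For every convex \<open>S\<close> that contains \<open>x\<close>, the two bounds show that \<open>x\<close> minimizes \<open>F + dist(_, S)\<close> if and only if
  \<open>U \<bullet> (y - x) \<le> dist(y, S)\<close> for all \<open>y\<close> (\<open>minimizer_sum_infdist_iff\<close>); in the language
  of convex analysis, \<open>U\<close> is a subgradient at \<open>x\<close> of the distance to \<open>S\<close>. For a flat \<open>S\<close> such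
  subgradients are the vectors of norm at most one orthogonal to \<open>S\<close>
  (\<open>subgradient_infdist_affine_iff\<close>).
\<close>

lemma unit_toward_eq_sgn: "unit_toward x S = sgn (closest_point S x - x)"
  by (simp add: unit_toward_def sgn_div_norm)

lemma infdist_greatest:
  assumes "S \<noteq> {}" "\<And>s. s \<in> S \<Longrightarrow> c \<le> dist y s"
  shows "c \<le> infdist y S"
  using assms by (simp add: infdist_notempty cINF_greatest)

lemma infdist_eq_norm_closest_point:
  fixes S :: "'a::euclidean_space set"
  assumes "closed S" "S \<noteq> {}"
  shows "infdist x S = norm (closest_point S x - x)"
  using setdist_closest_point[OF assms, of x] assms
  by (simp add: infdist_eq_setdist dist_norm norm_minus_commute)

text \<open>
  The set \<open>S\<close> lies beyond the hyperplane through the projection of \<open>x\<close> with normal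
  \<open>unit_toward x S\<close>, so the distance from \<open>y\<close> to \<open>S\<close> is at least the signed distance from \<open>y\<close>
  to this hyperplane. The bound also holds for \<open>x \<in> S\<close>, where \<open>unit_toward x S\<close> is zero.
\<close>

lemma infdist_ge_linearization:
  fixes S :: "'a::euclidean_space set"
  assumes "closed S" "convex S" "S \<noteq> {}"
  shows "infdist x S - unit_toward x S \<bullet> (y - x) \<le> infdist y S"
proof -
  define p where "p = closest_point S x"
  define u where "u = unit_toward x S"
  have u: "u = sgn (p - x)"
    by (simp add: u_def p_def unit_toward_eq_sgn)
  have "norm (p - x) - u \<bullet> (y - x) \<le> dist y k" if "k \<in> S" for k
  proof -
    have "(x - p) \<bullet> (k - p) \<le> 0"
      unfolding p_def using assms that by (intro closest_point_dot)
    then have "0 \<le> (p - x) \<bullet> (k - p)"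
      by (metis inner_minus_left minus_diff_eq neg_0_le_iff_le)
    then have "0 \<le> u \<bullet> (k - p)"
      by (simp add: u sgn_div_norm)
    moreover have "u \<bullet> (p - x) = norm (p - x)"
      by (cases "p = x") (simp_all add: u sgn_div_norm dot_square_norm power2_eq_square)
    moreover have "u \<bullet> (k - y) \<le> norm (k - y)"
    proof -
      have "u \<bullet> (k - y) \<le> norm u * norm (k - y)"
        by (rule norm_cauchy_schwarz)
      also have "\<dots> \<le> norm (k - y)"
        by (simp add: u norm_sgn)
      finally show ?thesis .
    qed
    ultimately show ?thesis
      by (simp add: inner_diff_right dist_norm norm_minus_commute)
  qed
  then have "norm (p - x) - u \<bullet> (y - x) \<le> infdist y S"
    using assms by (intro infdist_greatest)
  then show ?thesis
    using assms by (simp add: infdist_eq_norm_closest_point p_def u_def)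
qed

lemma DERIV_norm_diff_line:
  fixes p x v :: "'a::real_inner"
  assumes "p \<noteq> x"
  shows "((\<lambda>t. norm (p - (x + t *\<^sub>R v))) has_real_derivative - (sgn (p - x) \<bullet> v)) (at 0)"
proof -
  have "((\<lambda>t. p - (x + t *\<^sub>R v)) has_derivative (\<lambda>t. - (t *\<^sub>R v))) (at 0)"
    by (auto intro!: derivative_eq_intros)
  moreover have "(norm has_derivative (\<lambda>h. h \<bullet> sgn (p - x))) (at (p - (x + 0 *\<^sub>R v)))"
    using has_derivative_norm[of "p - x"] assms by simp
  ultimately have "((\<lambda>t. norm (p - (x + t *\<^sub>R v))) has_derivative
      (\<lambda>t. - (t *\<^sub>R v) \<bullet> sgn (p - x))) (at 0)"
    by (rule has_derivative_compose)
  then show ?thesis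
    by (rule has_derivative_imp_has_field_derivative) (simp add: inner_commute)
qed

text \<open>
  Sufficiency is the sum of the bounds \<open>infdist_ge_linearization\<close>. For necessity, replacing each \<open>infdist y (K i)\<close> by the distance to the fixed projection \<open>p i\<close> and
  \<open>infdist y S\<close> by the distance to a point moving linearly from \<open>x\<close> to \<open>s\<close> gives, on a segment
  issuing from \<open>x\<close>, a function that is differentiable at \<open>x\<close> and has its minimum there, so its
  derivative along the segment is nonnegative.
\<close>

theorem minimizer_sum_infdist_iff:
  fixes K :: "'i \<Rightarrow> 'a::euclidean_space set"
  assumes K: "\<And>i. i \<in> I \<Longrightarrow> closed (K i)" "\<And>i. i \<in> I \<Longrightarrow> convex (K i)"
      "\<And>i. i \<in> I \<Longrightarrow> K i \<noteq> {}" "\<And>i. i \<in> I \<Longrightarrow> x \<notin> K i"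
    and S: "convex S" "x \<in> S"
  shows "is_arg_min (\<lambda>y. (\<Sum>i\<in>I. infdist y (K i)) + infdist y S) (\<lambda>_. True) x \<longleftrightarrow>
    (\<forall>y. (\<Sum>i\<in>I. unit_toward x (K i)) \<bullet> (y - x) \<le> infdist y S)"
    (is "?min \<longleftrightarrow> (\<forall>y. ?U \<bullet> (y - x) \<le> infdist y S)")
proof
  assume R: "\<forall>y. ?U \<bullet> (y - x) \<le> infdist y S"
  have "(\<Sum>i\<in>I. infdist x (K i)) + infdist x S \<le> (\<Sum>i\<in>I. infdist y (K i)) + infdist y S" for y
  proof -
    have "(\<Sum>i\<in>I. infdist x (K i) - unit_toward x (K i) \<bullet> (y - x)) \<le> (\<Sum>i\<in>I. infdist y (K i))"
      using K by (intro sum_mono infdist_ge_linearization) auto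
    then show ?thesis
      using R[rule_format, of y] S by (simp add: sum_subtractf inner_sum_left)
  qed
  then show ?min
    by (simp add: is_arg_min_def not_less)
next
  assume ?min
  then have min: "(\<Sum>i\<in>I. infdist x (K i)) \<le> (\<Sum>i\<in>I. infdist y (K i)) + infdist y S" for y
    using S by (auto simp: is_arg_min_def not_less)
  define p where "p i = closest_point (K i) x" for i
  have pK: "p i \<in> K i" if "i \<in> I" for i
    using K that by (simp add: p_def closest_point_in_set)
  have "?U \<bullet> (y - x) \<le> dist y s" if s: "s \<in> S" for y s
  proof (rule ccontr)
    assume neg: "\<not> ?thesis"
    define h where "h t = (\<Sum>i\<in>I. norm (p i - (x + t *\<^sub>R (y - x)))) + t * dist y s" for t
    have "(h has_real_derivative (\<Sum>i\<in>I. - (sgn (p i - x) \<bullet> (y - x))) + dist y s) (at 0)"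
      unfolding h_def using pK K
      by (auto intro!: derivative_eq_intros DERIV_norm_diff_line)
    then have "(h has_real_derivative dist y s - ?U \<bullet> (y - x)) (at 0)"
      by (simp add: unit_toward_eq_sgn p_def inner_sum_left sum_negf)
    then obtain d where d: "d > 0" "\<And>t. 0 < t \<Longrightarrow> t < d \<Longrightarrow> h t < h 0"
      using DERIV_neg_dec_right[of h "dist y s - ?U \<bullet> (y - x)" 0] neg by auto
    define t where "t = min (d / 2) 1"
    have t: "0 < t" "t < d" "t \<le> 1"
      using d(1) by (auto simp: t_def)
    define z where "z = x + t *\<^sub>R (y - x)"
    have "h 0 = (\<Sum>i\<in>I. infdist x (K i))"
      using K by (simp add: h_def p_def infdist_eq_norm_closest_point)
    also have "\<dots> \<le> (\<Sum>i\<in>I. infdist z (K i)) + infdist z S"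
      by (rule min)
    also have "\<dots> \<le> h t"
      unfolding h_def
    proof (rule add_mono)
      show "(\<Sum>i\<in>I. infdist z (K i)) \<le> (\<Sum>i\<in>I. norm (p i - (x + t *\<^sub>R (y - x))))"
      proof (rule sum_mono)
        fix i assume "i \<in> I"
        then show "infdist z (K i) \<le> norm (p i - (x + t *\<^sub>R (y - x)))"
          using infdist_le[OF pK, of i z] by (simp add: dist_norm norm_minus_commute z_def)
      qed
      have "x + t *\<^sub>R (s - x) = (1 - t) *\<^sub>R x + t *\<^sub>R s"
        by (simp add: algebra_simps)
      also have "\<dots> \<in> S"
        using S s t by (intro convexD) auto
      finally have "infdist z S \<le> dist z (x + t *\<^sub>R (s - x))"
        by (rule infdist_le)
      also have "z - (x + t *\<^sub>R (s - x)) = t *\<^sub>R (y - s)"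
        by (simp add: z_def algebra_simps)
      then have "dist z (x + t *\<^sub>R (s - x)) = t * dist y s"
        using t by (simp add: dist_norm)
      finally show "infdist z S \<le> t * dist y s" .
    qed
    finally show False
      using d(2)[OF t(1,2)] by simp
  qed
  then show "\<forall>y. ?U \<bullet> (y - x) \<le> infdist y S"
    using S by (intro infdist_greatest allI) auto
qed

lemma subgradient_infdist_affine_iff:
  fixes S :: "'a::euclidean_space set"
  assumes S: "affine S" "x \<in> S"
  shows "(\<forall>y. u \<bullet> (y - x) \<le> infdist y S) \<longleftrightarrow> orthogonal_to_flat u x S \<and> norm u \<le> 1"
proof (intro iffI conjI allI)
  assume u: "\<forall>y. u \<bullet> (y - x) \<le> infdist y S"
  have le: "u \<bullet> (s - x) \<le> 0" if "s \<in> S" for s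
    using u[rule_format, of s] that by simp
  show "orthogonal_to_flat u x S"
    unfolding orthogonal_to_flat_def orthogonal_def
  proof safe
    fix s assume s: "s \<in> S"
    \<comment> \<open>The reflection of \<open>s\<close> in \<open>x\<close> also lies in the flat, which gives the opposite inequality.\<close>
    have "2 *\<^sub>R x + (- 1) *\<^sub>R s \<in> S"
      using S s by (intro mem_affine) auto
    from le[OF this] le[OF s] show "u \<bullet> (s - x) = 0"
      by (simp add: inner_diff_right scaleR_2 inner_add_right)
  qed
  have "u \<bullet> ((x + u) - x) \<le> infdist (x + u) S"
    using u by blast
  also have "\<dots> \<le> dist (x + u) x"
    using S by (intro infdist_le)
  finally have "norm u * norm u \<le> 1 * norm u"
    by (simp add: dist_norm dot_square_norm power2_eq_square)
  then show "norm u \<le> 1"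
    by (cases "u = 0") simp_all
next
  fix y
  assume u: "orthogonal_to_flat u x S \<and> norm u \<le> 1"
  have "u \<bullet> (y - x) \<le> dist y s" if "s \<in> S" for s
  proof -
    have "u \<bullet> (s - x) = 0"
      using u that by (simp add: orthogonal_to_flat_def orthogonal_def)
    then have "u \<bullet> (y - x) = u \<bullet> (y - s)"
      by (simp add: inner_diff_right)
    also have "\<dots> \<le> norm u * norm (y - s)"
      by (rule norm_cauchy_schwarz)
    also have "\<dots> \<le> dist y s"
      using u by (simp add: dist_norm mult_left_le_one_le)
    finally show ?thesis .
  qed
  then show "u \<bullet> (y - x) \<le> infdist y S"
    using S by (intro infdist_greatest allI) auto
qed

lemma orthogonal_to_flat_UNIV: "orthogonal_to_flat u x UNIV \<longleftrightarrow> u = 0"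
proof
  assume "orthogonal_to_flat u x UNIV"
  then have "orthogonal u ((x + u) - x)"
    unfolding orthogonal_to_flat_def by blast
  then show "u = 0"
    by (simp add: orthogonal_def)
qed (simp add: orthogonal_to_flat_def orthogonal_def)

theorem theorem5p2:
  fixes K :: "nat \<Rightarrow> 'a::euclidean_space set" and n :: nat and xbar :: 'a
  assumes "n \<ge> 1"
    and "\<And>i. i \<in> {1..n} \<Longrightarrow> K i \<noteq> {}"
    and "\<And>i. i \<in> {1..n} \<Longrightarrow> closed (K i)"
    and "\<And>i. i \<in> {1..n} \<Longrightarrow> convex (K i)"
  shows
    "(xbar \<notin> (\<Union>i\<in>{1..n}. K i) \<longrightarrow>
        (is_arg_min (sum_dist K n) (\<lambda>_. True) xbar \<longleftrightarrow>
          (\<Sum>i=1..n. unit_toward xbar (K i)) = 0)) \<and>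
     (xbar \<notin> (\<Union>i\<in>{1..n-1}. K i) \<and> K n = {xbar} \<longrightarrow>
        (is_arg_min (sum_dist K n) (\<lambda>_. True) xbar \<longleftrightarrow>
          norm (\<Sum>i=1..n-1. unit_toward xbar (K i)) \<le> 1)) \<and>
     (xbar \<notin> (\<Union>i\<in>{1..n-1}. K i) \<and> xbar \<in> K n \<and> affine (K n) \<longrightarrow>
        (is_arg_min (sum_dist K n) (\<lambda>_. True) xbar \<longleftrightarrow>
          orthogonal_to_flat (\<Sum>i=1..n-1. unit_toward xbar (K i)) xbar (K n) \<and>
          norm (\<Sum>i=1..n-1. unit_toward xbar (K i)) \<le> 1))"
proof -
  have general: "is_arg_min (\<lambda>y. (\<Sum>i=1..m. infdist y (K i)) + infdist y S) (\<lambda>_. True) xbar \<longleftrightarrow>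
      orthogonal_to_flat (\<Sum>i=1..m. unit_toward xbar (K i)) xbar S \<and>
      norm (\<Sum>i=1..m. unit_toward xbar (K i)) \<le> 1"
    if "m \<le> n" "xbar \<notin> (\<Union>i\<in>{1..m}. K i)" "xbar \<in> S" "affine S" for m S
    unfolding subgradient_infdist_affine_iff[OF that(4,3), symmetric]
  proof (rule minimizer_sum_infdist_iff)
    fix i assume "i \<in> {1..m}"
    then show "closed (K i)" "convex (K i)" "K i \<noteq> {}" "xbar \<notin> K i"
      using assms(2-4)[of i] that by auto
  qed (use that in \<open>auto intro: affine_imp_convex\<close>)
  have floating: "sum_dist K n = (\<lambda>y. (\<Sum>i=1..n. infdist y (K i)) + infdist y UNIV)"
    by (simp add: sum_dist_def fun_eq_iff)
  have absorbed: "sum_dist K n = (\<lambda>y. (\<Sum>i=1..n-1. infdist y (K i)) + infdist y (K n))"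
    using assms(1) by (cases n) (simp_all add: sum_dist_def fun_eq_iff)
  show ?thesis
  proof (intro conjI impI)
    assume "xbar \<notin> (\<Union>i\<in>{1..n}. K i)"
    from general[OF order_refl this UNIV_I affine_UNIV]
    show "is_arg_min (sum_dist K n) (\<lambda>_. True) xbar \<longleftrightarrow> (\<Sum>i=1..n. unit_toward xbar (K i)) = 0"
      unfolding floating orthogonal_to_flat_UNIV by auto
  next
    assume "xbar \<notin> (\<Union>i\<in>{1..n-1}. K i) \<and> K n = {xbar}"
    then show "is_arg_min (sum_dist K n) (\<lambda>_. True) xbar \<longleftrightarrow>
        norm (\<Sum>i=1..n-1. unit_toward xbar (K i)) \<le> 1"
      unfolding absorbed using general[of "n - 1" "K n"]
      by (simp add: orthogonal_to_flat_def orthogonal_def)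
  next
    assume "xbar \<notin> (\<Union>i\<in>{1..n-1}. K i) \<and> xbar \<in> K n \<and> affine (K n)"
    then show "is_arg_min (sum_dist K n) (\<lambda>_. True) xbar \<longleftrightarrow>
        orthogonal_to_flat (\<Sum>i=1..n-1. unit_toward xbar (K i)) xbar (K n) \<and>
        norm (\<Sum>i=1..n-1. unit_toward xbar (K i)) \<le> 1"
      unfolding absorbed by (intro general) auto
  qed
qed

end
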